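(* Let $d\ge 2$ and let $H$ be a Reproducing Kernel Hilbert Space of functions $\mathbb{R}^d\to\mathbb{R}^d$ with reproducing kernel $K:\mathbb{R}^d\times\mathbb{R}^d\to\mathbb{R}^{d\times d}$. The map $u\mapsto u\circ\tau$ is an isometry in $H$ for every translation $\tau:x\mapsto x+t$ ($t\in\mathbb{R}^d$) if and only if there exists a function $\mathbf{k}:\mathbb{R}^d\to\mathbb{R}^{d\times d}$ such that $K(x,y)=\mathbf{k}(x-y)$ for all $x,y\in\mathbb{R}^d$.
   Context: A Hilbert space $H$ of $\mathbb{R}^d$-valued functions on a set $\Omega$ is a Reproducing Kernel Hilbert Space (RKHS) if for all $x\in\Omega$, $\alpha\in\mathbb{R}^d$ the functional $u\mapsto\alpha\cdot u(x)$ is continuous on $H$. Its reproducing kernel is the unique $K:\Omega\times\Omega\to\mathbb{R}^{d\times d}$ such that $K(\cdot,x)\alpha\in H$ and $\langle K(\cdot,x)\alpha,u\rangle_H=\alpha\cdot u(x)$ for all $u\in H$, $x\in\Omega$, $\alpha\in\mathbb{R}^d$. "The map is an isometry in $H$" means that it maps $H$ into $H$ and preserves the inner product. *)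

theory Defs
  imports "HOL-Analysis.Analysis"
begin

text \<open>
  A space of \<open>\<real>\<^sup>d\<close>-valued functions on \<open>\<Omega>\<close> is a carrier set \<open>H\<close> of functions with pointwise
  operations, together with an inner product \<open>ip\<close> that is meaningful only on \<open>H\<close>.  The set
  \<open>\<Omega>\<close> is the type \<open>'x\<close>, and \<open>d = CARD('d)\<close>.
\<close>

locale inner_product_function_space =
  fixes H :: "('x \<Rightarrow> real ^ 'd) set"
    and ip :: "('x \<Rightarrow> real ^ 'd) \<Rightarrow> ('x \<Rightarrow> real ^ 'd) \<Rightarrow> real"
  assumes zero_mem: "(\<lambda>x. 0) \<in> H"
    and add_mem: "\<lbrakk>u \<in> H; v \<in> H\<rbrakk> \<Longrightarrow> (\<lambda>x. u x + v x) \<in> H"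
    and scale_mem: "u \<in> H \<Longrightarrow> (\<lambda>x. c *\<^sub>R u x) \<in> H"
    and ip_commute: "\<lbrakk>u \<in> H; v \<in> H\<rbrakk> \<Longrightarrow> ip u v = ip v u"
    and ip_add_left:
      "\<lbrakk>u \<in> H; v \<in> H; w \<in> H\<rbrakk> \<Longrightarrow> ip (\<lambda>x. u x + v x) w = ip u w + ip v w"
    and ip_scale_left: "\<lbrakk>u \<in> H; v \<in> H\<rbrakk> \<Longrightarrow> ip (\<lambda>x. c *\<^sub>R u x) v = c * ip u v"
    and ip_nonneg: "u \<in> H \<Longrightarrow> 0 \<le> ip u u"
    and ip_eq_zeroD: "\<lbrakk>u \<in> H; ip u u = 0\<rbrakk> \<Longrightarrow> u = (\<lambda>x. 0)"
begin

text \<open>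
  The library locale \<open>Metric_space\<close> wants nonnegativity and symmetry also outside the carrier,
  hence the case distinction.
\<close>

definition hdist :: "('x \<Rightarrow> real ^ 'd) \<Rightarrow> ('x \<Rightarrow> real ^ 'd) \<Rightarrow> real" where
  "hdist u v =
    (if u \<in> H \<and> v \<in> H then sqrt (ip (\<lambda>x. u x - v x) (\<lambda>x. u x - v x)) else 0)"

lemma diff_mem: "\<lbrakk>u \<in> H; v \<in> H\<rbrakk> \<Longrightarrow> (\<lambda>x. u x - v x) \<in> H"
  using add_mem[OF _ scale_mem[of v "-1"], of u] by simp

lemma ip_add_right:
  "\<lbrakk>u \<in> H; v \<in> H; w \<in> H\<rbrakk> \<Longrightarrow> ip w (\<lambda>x. u x + v x) = ip w u + ip w v"
  using ip_add_left[of u v w] by (simp add: ip_commute[of w] add_mem)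

lemma ip_scale_right: "\<lbrakk>u \<in> H; v \<in> H\<rbrakk> \<Longrightarrow> ip u (\<lambda>x. c *\<^sub>R v x) = c * ip u v"
  using ip_scale_left[of v u c] by (simp add: ip_commute[of u] scale_mem)

lemma ip_zero: "ip (\<lambda>x. 0) (\<lambda>x. 0) = 0"
  using ip_scale_left[OF zero_mem zero_mem, of 0] by simp

lemma ip_add_self:
  assumes "u \<in> H" "v \<in> H"
  shows "ip (\<lambda>x. u x + v x) (\<lambda>x. u x + v x) = ip u u + 2 * ip u v + ip v v"
  using ip_add_left[OF assms add_mem[OF assms]] ip_add_right[OF assms assms(1)]
    ip_add_right[OF assms assms(2)] ip_commute[OF assms]
  by linarith

lemma Cauchy_Schwarz:
  assumes u: "u \<in> H" and v: "v \<in> H"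
  shows "ip u v \<le> sqrt (ip u u) * sqrt (ip v v)"
proof -
  have quad: "0 \<le> a\<^sup>2 * ip u u + 2 * a * b * ip u v + b\<^sup>2 * ip v v" for a b
  proof -
    let ?p = "\<lambda>x. a *\<^sub>R u x" and ?q = "\<lambda>x. b *\<^sub>R v x"
    have m: "?p \<in> H" "?q \<in> H" using u v scale_mem by auto
    have "0 \<le> ip (\<lambda>x. ?p x + ?q x) (\<lambda>x. ?p x + ?q x)"
      by (rule ip_nonneg[OF add_mem[OF m]])
    also have "\<dots> = ip ?p ?p + 2 * ip ?p ?q + ip ?q ?q"
      by (rule ip_add_self[OF m])
    also have "\<dots> = a\<^sup>2 * ip u u + 2 * a * b * ip u v + b\<^sup>2 * ip v v"
      using u v
      by (simp add: ip_scale_left ip_scale_right scale_mem power2_eq_square algebra_simps)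
    finally show ?thesis .
  qed
  have "(ip u v)\<^sup>2 \<le> ip u u * ip v v"
  proof (cases "ip v v = 0")
    case True
    then have "v = (\<lambda>x. 0)" using v ip_eq_zeroD by blast
    then have "ip u v = 0" using ip_scale_right[OF u zero_mem, of 0] by simp
    then show ?thesis using True by simp
  next
    case False
    then have pos: "0 < ip v v" using ip_nonneg[OF v] by simp
    have "0 \<le> ip v v * (ip u u * ip v v - (ip u v)\<^sup>2)"
      using quad[of "ip v v" "- ip u v"] by (simp add: power2_eq_square algebra_simps)
    then show ?thesis using pos by (simp add: zero_le_mult_iff)
  qed
  then show ?thesis
    by (simp add: real_le_rsqrt flip: real_sqrt_mult)
qed

sublocale metric: Metric_space H hdist
proof
  show "0 \<le> hdist u v" for u v
    by (simp add: hdist_def ip_nonneg diff_mem)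
  show "hdist u v = hdist v u" for u v
  proof (cases "u \<in> H \<and> v \<in> H")
    case True
    then have m: "(\<lambda>x. v x - u x) \<in> H" using diff_mem by blast
    have "ip (\<lambda>x. u x - v x) (\<lambda>x. u x - v x) = ip (\<lambda>x. v x - u x) (\<lambda>x. v x - u x)"
      using ip_scale_left[OF m scale_mem[OF m], of "-1" "-1"] ip_scale_right[OF m m, of "-1"]
      by simp
    then show ?thesis by (simp add: hdist_def)
  qed (auto simp: hdist_def)
  show "hdist u v = 0 \<longleftrightarrow> u = v" if "u \<in> H" "v \<in> H" for u v
  proof
    assume "hdist u v = 0"
    then have "(\<lambda>x. u x - v x) = (\<lambda>x. 0)"
      using that by (intro ip_eq_zeroD diff_mem) (auto simp: hdist_def)
    then show "u = v" by (auto simp: fun_eq_iff)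
  qed (simp add: hdist_def ip_zero)
  show "hdist u w \<le> hdist u v + hdist v w" if "u \<in> H" "v \<in> H" "w \<in> H" for u v w
  proof -
    let ?p = "\<lambda>x. u x - v x" and ?q = "\<lambda>x. v x - w x"
    have m: "?p \<in> H" "?q \<in> H" using that diff_mem by auto
    have "ip (\<lambda>x. ?p x + ?q x) (\<lambda>x. ?p x + ?q x) = ip ?p ?p + 2 * ip ?p ?q + ip ?q ?q"
      by (rule ip_add_self[OF m])
    also have "\<dots> \<le> (sqrt (ip ?p ?p) + sqrt (ip ?q ?q))\<^sup>2"
      using Cauchy_Schwarz[OF m] ip_nonneg[OF m(1)] ip_nonneg[OF m(2)]
      unfolding power2_sum by (simp only: real_sqrt_pow2)
    finally have "sqrt (ip (\<lambda>x. ?p x + ?q x) (\<lambda>x. ?p x + ?q x)) \<le> sqrt (ip ?p ?p) + sqrt (ip ?q ?q)"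
      using ip_nonneg[OF m(1)] ip_nonneg[OF m(2)]
      by (intro real_le_lsqrt add_nonneg_nonneg real_sqrt_ge_zero)
    then show ?thesis using that by (simp add: hdist_def)
  qed
qed

end

locale hilbert_function_space = inner_product_function_space +
  assumes complete: "metric.mcomplete"

locale rkhs = hilbert_function_space +
  assumes evaluation_continuous:
    "continuous_map metric.mtopology euclideanreal (\<lambda>u. \<alpha> \<bullet> u x)"

definition reproducing_kernel ::
  "('x \<Rightarrow> real ^ 'd) set \<Rightarrow> (('x \<Rightarrow> real ^ 'd) \<Rightarrow> ('x \<Rightarrow> real ^ 'd) \<Rightarrow> real)
    \<Rightarrow> ('x \<Rightarrow> 'x \<Rightarrow> real ^ 'd ^ 'd) \<Rightarrow> bool" where
  "reproducing_kernel H ip K \<longleftrightarrow>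
    (\<forall>x \<alpha>. (\<lambda>y. K y x *v \<alpha>) \<in> H) \<and>
    (\<forall>u \<in> H. \<forall>x \<alpha>. ip (\<lambda>y. K y x *v \<alpha>) u = \<alpha> \<bullet> u x)"

lemma (in inner_product_function_space) reproducing_kernel_unique:
  assumes K: "reproducing_kernel H ip K" and L: "reproducing_kernel H ip L"
  shows "K = L"
proof -
  have "K y x *v \<alpha> = L y x *v \<alpha>" for x y \<alpha>
  proof -
    let ?k = "\<lambda>y. K y x *v \<alpha>" and ?l = "\<lambda>y. L y x *v \<alpha>"
    have m: "?k \<in> H" "?l \<in> H" using K L by (auto simp: reproducing_kernel_def)
    have "\<beta> \<bullet> ?k y = \<beta> \<bullet> ?l y" for \<beta>
    proof -
      let ?ky = "\<lambda>z. K z y *v \<beta>"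
      have my: "?ky \<in> H" using K by (auto simp: reproducing_kernel_def)
      have "\<beta> \<bullet> ?k y = ip ?ky ?k" using K m by (auto simp: reproducing_kernel_def)
      also have "\<dots> = ip ?k ?ky" by (rule ip_commute[OF my m(1)])
      also have "\<dots> = \<alpha> \<bullet> ?ky x" using K my by (auto simp: reproducing_kernel_def)
      also have "\<dots> = ip ?l ?ky" using L my by (auto simp: reproducing_kernel_def)
      also have "\<dots> = ip ?ky ?l" by (rule ip_commute[OF m(2) my])
      also have "\<dots> = \<beta> \<bullet> ?l y" using K m by (auto simp: reproducing_kernel_def)
      finally show ?thesis .
    qed
    then show ?thesis by (metis vector_eq_rdot inner_commute)
  qed
  then show ?thesis by (intro ext) (simp add: matrix_eq)
qed

definition isometry_in ::
  "('x \<Rightarrow> real ^ 'd) set \<Rightarrow> (('x \<Rightarrow> real ^ 'd) \<Rightarrow> ('x \<Rightarrow> real ^ 'd) \<Rightarrow> real)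
    \<Rightarrow> (('x \<Rightarrow> real ^ 'd) \<Rightarrow> ('x \<Rightarrow> real ^ 'd)) \<Rightarrow> bool" where
  "isometry_in H ip T \<longleftrightarrow>
    (\<forall>u \<in> H. T u \<in> H) \<and> (\<forall>u \<in> H. \<forall>v \<in> H. ip (T u) (T v) = ip u v)"

end

theory Submission
  imports Defs
begin

text \<open>
  If \<open>\<sigma>\<close> is a left inverse of \<open>\<tau>\<close> and composition with \<open>\<tau>\<close> is an isometry, then
  \<open>\<langle>K(\<tau> \<cdot>, \<tau> x)\<alpha>, u\<rangle> = \<langle>K(\<cdot>, \<tau> x)\<alpha>, u \<circ> \<sigma>\<rangle> = \<alpha> \<cdot> u(x)\<close>, so by uniqueness of the
  reproducing kernel \<open>K(\<tau> y, \<tau> x) = K(y, x)\<close>.  Conversely, if \<open>K\<close> is invariant under a surjective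
  \<open>\<tau>\<close>, the functions on which composition with \<open>\<tau>\<close> behaves isometrically form a closed
  subspace containing all kernel sections \<open>K(\<cdot>, x)\<alpha>\<close>.  A function orthogonal to all
  kernel sections vanishes, so by the projection theorem this subspace is all of \<open>H\<close>.
\<close>

section \<open>Continuity of the inner product and the parallelogram law\<close>

context inner_product_function_space
begin

lemma ip_diff_left:
  assumes "u \<in> H" "v \<in> H" "w \<in> H"
  shows "ip (\<lambda>x. u x - v x) w = ip u w - ip v w"
  using ip_add_left[OF diff_mem[OF assms(1,2)] assms(2,3)] by simp

lemma ip_diff_right:
  assumes "u \<in> H" "v \<in> H" "w \<in> H"
  shows "ip w (\<lambda>x. u x - v x) = ip w u - ip w v"
  using ip_add_right[OF diff_mem[OF assms(1,2)] assms(2,3)] by simp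

lemma abs_ip_le:
  assumes "u \<in> H" "v \<in> H"
  shows "\<bar>ip u v\<bar> \<le> sqrt (ip u u) * sqrt (ip v v)"
  using Cauchy_Schwarz[OF assms] Cauchy_Schwarz[OF scale_mem[OF assms(1), of "-1"] assms(2)]
    ip_scale_left[OF assms, of "-1"] ip_scale_left[OF assms(1) scale_mem[OF assms(1)], of "-1" "-1"]
    ip_scale_right[OF assms(1) assms(1), of "-1"]
  by simp

text \<open>Cauchy-Schwarz bounds the error by \<open>hdist (f n) u\<close> times the norm of
  \<open>w\<close>. With kernel sections as \<open>w\<close>, this turns convergence in
  \<open>H\<close> into pointwise convergence.\<close>

lemma tendsto_ip_left:
  assumes lim: "limitin metric.mtopology f u sequentially" and w: "w \<in> H"
  shows "(\<lambda>n. ip (f n) w) \<longlonglongrightarrow> ip u w"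
proof -
  have u: "u \<in> H" and d0: "(\<lambda>n. hdist (f n) u) \<longlonglongrightarrow> 0" and ev: "\<forall>\<^sub>F n in sequentially. f n \<in> H"
    using lim by (auto simp: metric.limitin_metric_dist_null)
  have "\<forall>\<^sub>F n in sequentially. norm (ip (f n) w - ip u w) \<le> hdist (f n) u * sqrt (ip w w)"
    using ev
  proof eventually_elim
    case (elim n)
    show ?case
      using abs_ip_le[OF diff_mem[OF elim u] w] elim u w by (simp add: ip_diff_left hdist_def)
  qed
  moreover have "(\<lambda>n. hdist (f n) u * sqrt (ip w w)) \<longlonglongrightarrow> 0"
    using tendsto_mult_right[OF d0, of "sqrt (ip w w)"] by simp
  ultimately have "(\<lambda>n. ip (f n) w - ip u w) \<longlonglongrightarrow> 0"
    by (rule Lim_null_comparison)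
  then show ?thesis by (simp add: LIM_zero_iff)
qed

text \<open>The parallelogram law for \<open>u - a\<close> and \<open>u - b\<close>, whose sum is
  twice the difference between \<open>u\<close> and the midpoint of \<open>a\<close> and
  \<open>b\<close>. It makes minimizing sequences Cauchy.\<close>

lemma parallelogram_midpoint:
  assumes "u \<in> H" "a \<in> H" "b \<in> H"
  shows "ip (\<lambda>x. a x - b x) (\<lambda>x. a x - b x) =
    2 * ip (\<lambda>x. u x - a x) (\<lambda>x. u x - a x) + 2 * ip (\<lambda>x. u x - b x) (\<lambda>x. u x - b x)
    - 4 * ip (\<lambda>x. u x - (1/2) *\<^sub>R (a x + b x)) (\<lambda>x. u x - (1/2) *\<^sub>R (a x + b x))"
  using assms ip_commute[OF assms(1,2)] ip_commute[OF assms(1,3)] ip_commute[OF assms(2,3)]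
  by (simp add: ip_diff_left ip_diff_right ip_scale_left ip_scale_right ip_add_left ip_add_right
      add_mem diff_mem scale_mem add_divide_distrib)

end

section \<open>Orthogonal projection onto a closed subspace\<close>

lemma quadratic_bound_imp_zero:
  fixes c w :: real
  assumes "\<And>s. 2 * s * c \<le> s\<^sup>2 * w" and "0 \<le> w"
  shows "c = 0"
proof -
  \<comment> \<open>Adding 1 keeps the denominator positive when \<open>w = 0\<close>. For this
    \<open>s\<close> the hypothesis becomes \<open>s\<^sup>2 * (w + 2) \<le> 0\<close>.\<close>
  define s where "s = c / (w + 1)"
  have c: "c = s * (w + 1)" using assms(2) by (simp add: s_def)
  have "s\<^sup>2 * (w + 2) \<le> 0"
    using assms(1)[of s] unfolding c by (simp add: power2_eq_square algebra_simps)
  then show ?thesis using assms(2) by (simp add: c mult_le_0_iff)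
qed

text \<open>A minimizing sequence for the squared distance from \<open>u\<close> to \<open>V\<close>
  is Cauchy. Its limit \<open>m\<close> lies in \<open>V\<close> by closedness, and near-minimality
  tested along each \<open>w\<close> in \<open>V\<close> forces \<open>u - m\<close> to be
  orthogonal to \<open>w\<close>.\<close>

lemma (in hilbert_function_space) orthogonal_decomposition:
  assumes V: "V \<subseteq> H" "(\<lambda>x. 0) \<in> V"
    and add: "\<And>u v. \<lbrakk>u \<in> V; v \<in> V\<rbrakk> \<Longrightarrow> (\<lambda>x. u x + v x) \<in> V"
    and scale: "\<And>u c. u \<in> V \<Longrightarrow> (\<lambda>x. c *\<^sub>R u x) \<in> V"
    and closed: "\<And>f u. \<lbrakk>range f \<subseteq> V; limitin metric.mtopology f u sequentially\<rbrakk> \<Longrightarrow> u \<in> V"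
    and u: "u \<in> H"
  shows "\<exists>m \<in> V. \<forall>w \<in> V. ip (\<lambda>x. u x - m x) w = 0"
proof -
  define q where "q d = ip (\<lambda>x. u x - d x) (\<lambda>x. u x - d x)" for d
  define \<delta> where "\<delta> = Inf (q ` V)"
  have q_nonneg: "0 \<le> q d" if "d \<in> V" for d
    using that V u by (auto simp: q_def intro!: ip_nonneg diff_mem)
  have bdd: "bdd_below (q ` V)" using q_nonneg by (auto intro!: bdd_belowI[of _ 0])
  have \<delta>_le: "\<delta> \<le> q d" if "d \<in> V" for d
    unfolding \<delta>_def using bdd that by (auto intro: cINF_lower)
  have "\<exists>d\<in>V. q d < \<delta> + 1 / real (Suc n)" for n
  proof -
    have "Inf (q ` V) < \<delta> + 1 / real (Suc n)" by (simp add: \<delta>_def)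
    then show ?thesis using V(2) bdd by (subst (asm) cInf_less_iff) auto
  qed
  then obtain d where d: "\<And>n. d n \<in> V" "\<And>n. q (d n) < \<delta> + 1 / real (Suc n)" by metis
  have dH: "d n \<in> H" for n using d V by auto
  have dist_le: "(hdist (d n) (d k))\<^sup>2 \<le> 2 / real (Suc n) + 2 / real (Suc k)" for n k
  proof -
    \<comment> \<open>The midpoint lies in \<open>V\<close>, so four times its value is at least 4
      \<delta>. This cancels the 4 \<delta> from the two near-minimal values and leaves only their
      errors.\<close>
    have "\<delta> \<le> q (\<lambda>x. (1/2) *\<^sub>R (d n x + d k x))"
      by (intro \<delta>_le scale add d)
    moreover have "(hdist (d n) (d k))\<^sup>2
        = 2 * q (d n) + 2 * q (d k) - 4 * q (\<lambda>x. (1/2) *\<^sub>R (d n x + d k x))"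
      unfolding q_def parallelogram_midpoint[OF u dH dH, symmetric]
      by (simp add: hdist_def dH ip_nonneg diff_mem)
    ultimately show ?thesis using d(2)[of n] d(2)[of k] by simp
  qed
  have "metric.MCauchy d"
    unfolding metric.MCauchy_def
  proof (intro conjI allI impI)
    show "range d \<subseteq> H" using dH by auto
    fix e :: real assume "0 < e"
    \<comment> \<open>Chosen so that each of the two terms in \<open>dist_le\<close> falls below
      \<open>e\<^sup>2 / 2\<close>.\<close>
    then obtain N where N: "4 / e\<^sup>2 < real N" using reals_Archimedean2 by blast
    have "hdist (d n) (d k) < e" if "N \<le> n" "N \<le> k" for n k
    proof -
      have "2 / real (Suc j) < e\<^sup>2 / 2" if "N \<le> j" for j
      proof -
        have "4 / e\<^sup>2 < real (Suc j)" using N that by simp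
        then show ?thesis using \<open>0 < e\<close> by (simp add: field_simps)
      qed
      from this[OF that(1)] this[OF that(2)] dist_le[of n k]
      have "(hdist (d n) (d k))\<^sup>2 < e\<^sup>2" by linarith
      then show ?thesis by (rule power2_less_imp_less) (use \<open>0 < e\<close> in simp)
    qed
    then show "\<exists>N. \<forall>n n'. N \<le> n \<longrightarrow> N \<le> n' \<longrightarrow> hdist (d n) (d n') < e" by blast
  qed
  then obtain m where m: "limitin metric.mtopology d m sequentially"
    using complete unfolding metric.mcomplete_def by blast
  have mV: "m \<in> V" using closed[OF _ m] d(1) by auto
  have "ip (\<lambda>x. u x - m x) w = 0" if w: "w \<in> V" for w
  proof (rule quadratic_bound_imp_zero)
    have wH: "w \<in> H" and mH: "m \<in> H" using w V mV by auto
    show "0 \<le> ip w w" by (rule ip_nonneg[OF wH])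
    fix s
    \<comment> \<open>Compare \<open>d n\<close> with its perturbation along \<open>w\<close>. The
      error from near-minimality vanishes as \<open>n\<close> grows, leaving the quadratic
      inequality for \<open>m\<close>.\<close>
    have bound: "2 * s * (ip u w - ip (d n) w) \<le> 1 / real (Suc n) + s\<^sup>2 * ip w w" for n
    proof -
      have "\<delta> \<le> q (\<lambda>x. d n x + s *\<^sub>R w x)"
        by (intro \<delta>_le add scale d w)
      also have "\<dots> = q (d n) - 2 * s * (ip u w - ip (d n) w) + s\<^sup>2 * ip w w"
        using u dH wH ip_commute[OF u wH] ip_commute[OF dH[of n] wH] ip_commute[OF u dH[of n]]
        by (simp add: q_def ip_diff_left ip_diff_right ip_scale_left ip_scale_right ip_add_left
            ip_add_right add_mem diff_mem scale_mem power2_eq_square algebra_simps)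
      finally show ?thesis using d(2)[of n] by simp
    qed
    have "2 * s * (ip u w - ip m w) \<le> 0 + s\<^sup>2 * ip w w"
    proof (rule LIMSEQ_le)
      show "(\<lambda>n. 2 * s * (ip u w - ip (d n) w)) \<longlonglongrightarrow> 2 * s * (ip u w - ip m w)"
        by (intro tendsto_intros tendsto_ip_left m wH)
      show "(\<lambda>n. 1 / real (Suc n) + s\<^sup>2 * ip w w) \<longlonglongrightarrow> 0 + s\<^sup>2 * ip w w"
        by (intro tendsto_add tendsto_const LIMSEQ_Suc lim_1_over_n)
    qed (use bound in blast)
    then show "2 * s * ip (\<lambda>x. u x - m x) w \<le> s\<^sup>2 * ip w w"
      by (simp add: ip_diff_left u mH wH)
  qed
  with mV show ?thesis by blast
qed

text \<open>Kernel sections span a dense subspace: the part of \<open>u\<close> orthogonal to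
  \<open>V\<close> pairs to zero with every section, so by the reproducing property all its values
  vanish.\<close>

lemma (in hilbert_function_space) closed_subspace_eq_if_kernel_sections:
  assumes K: "reproducing_kernel H ip K"
    and V: "V \<subseteq> H" "(\<lambda>x. 0) \<in> V"
    and add: "\<And>u v. \<lbrakk>u \<in> V; v \<in> V\<rbrakk> \<Longrightarrow> (\<lambda>x. u x + v x) \<in> V"
    and scale: "\<And>u c. u \<in> V \<Longrightarrow> (\<lambda>x. c *\<^sub>R u x) \<in> V"
    and closed: "\<And>f u. \<lbrakk>range f \<subseteq> V; limitin metric.mtopology f u sequentially\<rbrakk> \<Longrightarrow> u \<in> V"
    and sections: "\<And>x \<alpha>. (\<lambda>y. K y x *v \<alpha>) \<in> V"
  shows "V = H"
proof
  show "H \<subseteq> V"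
  proof
    fix u assume u: "u \<in> H"
    have "\<exists>m \<in> V. \<forall>w \<in> V. ip (\<lambda>x. u x - m x) w = 0"
      by (rule orthogonal_decomposition) (fact V add scale closed u)+
    then obtain m where m: "m \<in> V" and orth: "\<And>w. w \<in> V \<Longrightarrow> ip (\<lambda>x. u x - m x) w = 0"
      by blast
    have dH: "(\<lambda>x. u x - m x) \<in> H" using u m V diff_mem by blast
    have "\<alpha> \<bullet> (u x - m x) = 0" for \<alpha> x
    proof -
      have "\<alpha> \<bullet> (u x - m x) = ip (\<lambda>y. K y x *v \<alpha>) (\<lambda>x. u x - m x)"
        using K dH by (simp add: reproducing_kernel_def)
      also have "\<dots> = ip (\<lambda>x. u x - m x) (\<lambda>y. K y x *v \<alpha>)"
        using sections V dH by (intro ip_commute) auto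
      finally show ?thesis using orth[OF sections] by simp
    qed
    then have "u x - m x = 0" for x using inner_eq_zero_iff by blast
    then have "u = m" by (auto simp: fun_eq_iff)
    with m show "u \<in> V" by simp
  qed
qed (rule V(1))

section \<open>Isometric composition operators and invariant kernels\<close>

lemma (in inner_product_function_space) kernel_invariant_if_isometry:
  assumes K: "reproducing_kernel H ip K"
    and \<tau>: "isometry_in H ip (\<lambda>u. u \<circ> \<tau>)"
    and \<sigma>: "\<And>u. u \<in> H \<Longrightarrow> u \<circ> \<sigma> \<in> H" "\<And>x. \<sigma> (\<tau> x) = x"
  shows "K (\<tau> y) (\<tau> x) = K y x"
proof -
  have "reproducing_kernel H ip (\<lambda>y x. K (\<tau> y) (\<tau> x))"
    unfolding reproducing_kernel_def
  proof (intro conjI allI ballI)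
    fix x \<alpha>
    have sec: "(\<lambda>y. K y (\<tau> x) *v \<alpha>) \<in> H" using K by (simp add: reproducing_kernel_def)
    then show "(\<lambda>y. K (\<tau> y) (\<tau> x) *v \<alpha>) \<in> H"
      using \<tau> unfolding isometry_in_def by (force simp: o_def)
    fix u assume u: "u \<in> H"
    \<comment> \<open>Since \<open>(u \<circ> \<sigma>) \<circ> \<tau> = u\<close>, both arguments
      are compositions with \<tau> and the isometry applies to the pair.\<close>
    have "ip ((\<lambda>y. K y (\<tau> x) *v \<alpha>) \<circ> \<tau>) ((u \<circ> \<sigma>) \<circ> \<tau>) = ip (\<lambda>y. K y (\<tau> x) *v \<alpha>) (u \<circ> \<sigma>)"
      using \<tau> sec \<sigma>(1)[OF u] unfolding isometry_in_def by blast
    also have "\<dots> = \<alpha> \<bullet> u x"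
      using K \<sigma>(1)[OF u] by (simp add: reproducing_kernel_def \<sigma>(2))
    finally show "ip (\<lambda>y. K (\<tau> y) (\<tau> x) *v \<alpha>) u = \<alpha> \<bullet> u x" by (simp add: o_def \<sigma>(2))
  qed
  from reproducing_kernel_unique[OF this K] show ?thesis by (simp add: fun_eq_iff)
qed

lemma (in hilbert_function_space) isometry_if_kernel_invariant:
  assumes K: "reproducing_kernel H ip K"
    and inv: "\<And>x y. K (\<tau> y) (\<tau> x) = K y x"
    and surj: "surj \<tau>"
  shows "isometry_in H ip (\<lambda>u. u \<circ> \<tau>)"
proof -
  \<comment> \<open>A priori, composition with \<tau> may leave \<open>H\<close>. That it does not
    comes out only with \<open>V = H\<close>.\<close>
  define D where "D = {u \<in> H. u \<circ> \<tau> \<in> H}"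
  \<comment> \<open>Quantifying over \<open>D\<close> rather than \<open>V\<close> itself makes \<open>V\<close> visibly a subspace.\<close>
  define V where "V = {u \<in> D. \<forall>w \<in> D. ip (u \<circ> \<tau>) (w \<circ> \<tau>) = ip u w}"
  have K_mem: "(\<lambda>y. K y x *v \<alpha>) \<in> H" for x \<alpha>
    using K by (simp add: reproducing_kernel_def)
  have K_ip: "ip (\<lambda>y. K y x *v \<alpha>) u = \<alpha> \<bullet> u x" if "u \<in> H" for x \<alpha> u
    using K that by (simp add: reproducing_kernel_def)
  have zero: "(\<lambda>x. 0) \<in> V"
  proof -
    have "ip (\<lambda>x. 0) w = 0" if "w \<in> H" for w
      using ip_scale_left[OF zero_mem that, of 0] by simp
    then show ?thesis by (auto simp: V_def D_def o_def zero_mem)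
  qed
  have add: "(\<lambda>x. u x + v x) \<in> V" if "u \<in> V" "v \<in> V" for u v
    using that by (auto simp: V_def D_def o_def add_mem ip_add_left)
  have scale: "(\<lambda>x. c *\<^sub>R u x) \<in> V" if "u \<in> V" for u c
    using that by (auto simp: V_def D_def o_def scale_mem ip_scale_left)
  \<comment> \<open>Composition with \<tau> preserves distances on \<open>V\<close>, so the composed
    sequence is Cauchy too. Its limit \<open>v\<close> is identified with
    \<open>u \<circ> \<tau>\<close> through pointwise values.\<close>
  have closed: "u \<in> V"
    if f: "range f \<subseteq> V" and lim: "limitin metric.mtopology f u sequentially" for f u
  proof -
    have u: "u \<in> H" using lim by (auto simp: metric.limitin_metric_dist_null)
    have fV: "f n \<in> V" for n using f by auto
    then have fH: "f n \<in> H" and fT: "f n \<circ> \<tau> \<in> H" for n by (auto simp: V_def D_def)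
    have dist: "hdist (f n \<circ> \<tau>) (f k \<circ> \<tau>) = hdist (f n) (f k)" for n k
    proof -
      have "(\<lambda>x. f n x - f k x) \<in> V" using add[OF fV scale[OF fV, of "-1"], of n k] by simp
      then have "ip ((\<lambda>x. f n x - f k x) \<circ> \<tau>) ((\<lambda>x. f n x - f k x) \<circ> \<tau>)
          = ip (\<lambda>x. f n x - f k x) (\<lambda>x. f n x - f k x)"
        by (auto simp: V_def)
      then show ?thesis using fH fT by (simp add: hdist_def o_def)
    qed
    have "metric.MCauchy f"
      using metric.convergent_imp_MCauchy[OF _ lim] fH by auto
    then have "metric.MCauchy (\<lambda>n. f n \<circ> \<tau>)"
      using fT unfolding metric.MCauchy_def dist by auto
    then obtain v where v: "limitin metric.mtopology (\<lambda>n. f n \<circ> \<tau>) v sequentially"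
      using complete unfolding metric.mcomplete_def by blast
    have vH: "v \<in> H" using v by (auto simp: metric.limitin_metric_dist_null)
    have "\<alpha> \<bullet> v x = \<alpha> \<bullet> u (\<tau> x)" for \<alpha> x
    proof (rule LIMSEQ_unique)
      show "(\<lambda>n. \<alpha> \<bullet> f n (\<tau> x)) \<longlonglongrightarrow> \<alpha> \<bullet> v x"
        using tendsto_ip_left[OF v K_mem[of x \<alpha>]] fT vH
        by (simp add: ip_commute[OF _ K_mem] K_ip)
      show "(\<lambda>n. \<alpha> \<bullet> f n (\<tau> x)) \<longlonglongrightarrow> \<alpha> \<bullet> u (\<tau> x)"
        using tendsto_ip_left[OF lim K_mem[of "\<tau> x" \<alpha>]] fH u
        by (simp add: ip_commute[OF _ K_mem] K_ip)
    qed
    then have veq: "v = u \<circ> \<tau>" unfolding fun_eq_iff by (metis comp_apply vector_eq_rdot inner_commute)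
    have "ip (u \<circ> \<tau>) (w \<circ> \<tau>) = ip u w" if w: "w \<in> D" for w
    proof (rule LIMSEQ_unique)
      show "(\<lambda>n. ip (f n) w) \<longlonglongrightarrow> ip u w"
        using w by (intro tendsto_ip_left lim) (simp add: D_def)
      have "ip (f n \<circ> \<tau>) (w \<circ> \<tau>) = ip (f n) w" for n using fV w by (auto simp: V_def)
      then show "(\<lambda>n. ip (f n) w) \<longlonglongrightarrow> ip (u \<circ> \<tau>) (w \<circ> \<tau>)"
        using tendsto_ip_left[OF v, of "w \<circ> \<tau>"] w veq by (simp add: D_def)
    qed
    then show ?thesis using u vH veq by (simp add: V_def D_def)
  qed
  have sections: "(\<lambda>y. K y x *v \<alpha>) \<in> V" for x \<alpha>
  proof -
    \<comment> \<open>Invariance takes the section at \<open>\<tau> x'\<close> to the section at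
      \<open>x'\<close>. Paired with \<open>w \<circ> \<tau>\<close> and with \<open>w\<close>, both
      give \<open>\<alpha> \<bullet> w (\<tau> x')\<close>.\<close>
    obtain x' where x: "x = \<tau> x'" using surj by blast
    have "(\<lambda>y. K y x *v \<alpha>) \<circ> \<tau> = (\<lambda>y. K y x' *v \<alpha>)" by (simp add: o_def x inv)
    then show ?thesis by (auto simp: V_def D_def K_mem K_ip x)
  qed
  have "V \<subseteq> H" by (auto simp: V_def D_def)
  then have "V = H"
    by (rule closed_subspace_eq_if_kernel_sections[OF K]) (fact zero add scale closed sections)+
  then show ?thesis unfolding isometry_in_def V_def D_def by blast
qed

section \<open>Specialization to translations\<close>

theorem theorem3p1:
  fixes H :: "(real ^ 'd \<Rightarrow> real ^ 'd) set"
    and ip :: "(real ^ 'd \<Rightarrow> real ^ 'd) \<Rightarrow> (real ^ 'd \<Rightarrow> real ^ 'd) \<Rightarrow> real"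
    and K :: "real ^ 'd \<Rightarrow> real ^ 'd \<Rightarrow> real ^ 'd ^ 'd"
  assumes "CARD('d) \<ge> 2"
    and "rkhs H ip"
    and "reproducing_kernel H ip K"
  shows "(\<forall>t :: real ^ 'd. isometry_in H ip (\<lambda>u. u \<circ> (\<lambda>x. x + t)))
    \<longleftrightarrow> (\<exists>k :: real ^ 'd \<Rightarrow> real ^ 'd ^ 'd. \<forall>x y. K x y = k (x - y))"
proof
  interpret rkhs H ip by fact
  assume iso: "\<forall>t :: real ^ 'd. isometry_in H ip (\<lambda>u. u \<circ> (\<lambda>x. x + t))"
  have mem: "u \<circ> (\<lambda>x. x + t) \<in> H" if "u \<in> H" for u t
    using iso that unfolding isometry_in_def by blast
  \<comment> \<open>Translating by \<open>- y\<close> moves the second argument to the origin, so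
    \<open>K\<close> is determined by its section at 0, which serves as \<open>k\<close>.\<close>
  have "K (x + - y) (y + - y) = K x y" for x y
    using kernel_invariant_if_isometry[where \<tau> = "\<lambda>x. x + - y"
        and \<sigma> = "\<lambda>x. x + y"
        and x = y and y = x, OF assms(3) iso[rule_format] mem]
    by simp
  then have "\<forall>x y. K x y = K (x - y) 0" by simp
  then show "\<exists>k. \<forall>x y. K x y = k (x - y)" by (rule exI[of _ "\<lambda>z. K z 0"])
next
  interpret rkhs H ip by fact
  assume "\<exists>k. \<forall>x y. K x y = k (x - y)"
  then obtain k where k: "\<And>x y. K x y = k (x - y)" by blast
  show "\<forall>t. isometry_in H ip (\<lambda>u. u \<circ> (\<lambda>x. x + t))"
    by (intro allI isometry_if_kernel_invariant[OF assms(3)])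
      (simp_all add: k surj_plus_right)
qed

end
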